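(* Let $\Gamma$ be a simplicial graph with finite chromatic number $\mathrm{chr}(\Gamma)$, let $G_v$ $(v\in V(\Gamma))$ be groups, and let $G=\mathcal{G}(\Gamma;G_v, v\in V(\Gamma))$ be their graph product over $\Gamma$. Then there is a series \[ G=G_0 \rhd G_1 \rhd \cdots \rhd G_{\mathrm{chr}(\Gamma)}=1, \] in which each $G_i$ is a normal subgroup of $G_{i-1}$, such that each factor $G_{i-1}/G_i$ is isomorphic to a free product of copies of vertex groups $G_v$ (that is, to a free product of a family of groups, each of which is isomorphic to some vertex group $G_v$, $v \in V(\Gamma)$).
   Context: Given a simplicial graph $\Gamma$ (no loops or multiple edges, possibly infinite) and a group $G_v$ for each vertex $v\in V(\Gamma)$, the graph product $\mathcal{G}(\Gamma;G_v, v\in V(\Gamma))$ is the quotient of the free product of the groups $G_v$ by the normal closure of the set of all commutators $[g_u,g_v]$ with $g_u\in G_u$, $g_v\in G_v$ and $u,v$ adjacent in $\Gamma$. The groups $G_v$ are called the vertex groups. The chromatic number $\mathrm{chr}(\Gamma)$ is the least number of colours needed to colour the vertices so that adjacent vertices receive different colours. *)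

theory Defs
  imports
    "HOL-Algebra.Algebra"
    "HOL-Library.Extended_Nat"
    "Graph_Theory.Pair_Digraph"
begin

section \<open>Free products\<close>

text \<open>
  The free product of the groups \<open>G i\<close> for \<open>i \<in> I\<close> is the monoid of words in the disjoint union of
  the carriers, modulo the congruence that deletes identity letters and multiplies adjacent
  letters of the same factor. All factors share one HOL type but may have different carriers.
\<close>

definition fp_words :: "'i set \<Rightarrow> ('i \<Rightarrow> ('a, 'm) monoid_scheme) \<Rightarrow> ('i \<times> 'a) list set"
  where "fp_words I G = lists (SIGMA i:I. carrier (G i))"

inductive_set fp_rel ::
  "'i set \<Rightarrow> ('i \<Rightarrow> ('a, 'm) monoid_scheme) \<Rightarrow> (('i \<times> 'a) list \<times> ('i \<times> 'a) list) set"
  for I :: "'i set" and G :: "'i \<Rightarrow> ('a, 'm) monoid_scheme"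
  where
    refl: "w \<in> fp_words I G \<Longrightarrow> (w, w) \<in> fp_rel I G"
  | sym: "(u, w) \<in> fp_rel I G \<Longrightarrow> (w, u) \<in> fp_rel I G"
  | trans: "(u, v) \<in> fp_rel I G \<Longrightarrow> (v, w) \<in> fp_rel I G \<Longrightarrow> (u, w) \<in> fp_rel I G"
  | one: "u \<in> fp_words I G \<Longrightarrow> w \<in> fp_words I G \<Longrightarrow> i \<in> I
      \<Longrightarrow> (u @ [(i, \<one>\<^bsub>G i\<^esub>)] @ w, u @ w) \<in> fp_rel I G"
  | mult: "u \<in> fp_words I G \<Longrightarrow> w \<in> fp_words I G \<Longrightarrow> i \<in> I
      \<Longrightarrow> a \<in> carrier (G i) \<Longrightarrow> b \<in> carrier (G i)
      \<Longrightarrow> (u @ [(i, a), (i, b)] @ w, u @ [(i, a \<otimes>\<^bsub>G i\<^esub> b)] @ w) \<in> fp_rel I G"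

definition free_product ::
  "'i set \<Rightarrow> ('i \<Rightarrow> ('a, 'm) monoid_scheme) \<Rightarrow> ('i \<times> 'a) list set monoid"
  where "free_product I G =
    \<lparr>carrier = fp_words I G // fp_rel I G,
     monoid.mult = (\<lambda>A B. \<Union>x\<in>A. \<Union>y\<in>B. fp_rel I G `` {x @ y}),
     one = fp_rel I G `` {[]}\<rparr>"

definition fp_incl ::
  "'i set \<Rightarrow> ('i \<Rightarrow> ('a, 'm) monoid_scheme) \<Rightarrow> 'i \<Rightarrow> 'a \<Rightarrow> ('i \<times> 'a) list set"
  where "fp_incl I G i a = fp_rel I G `` {[(i, a)]}"

lemma fp_words_simps [simp]:
  "[] \<in> fp_words I G"
  "(p # w) \<in> fp_words I G \<longleftrightarrow> fst p \<in> I \<and> snd p \<in> carrier (G (fst p)) \<and> w \<in> fp_words I G"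
  "(u @ w) \<in> fp_words I G \<longleftrightarrow> u \<in> fp_words I G \<and> w \<in> fp_words I G"
  by (cases p; auto simp: fp_words_def)+

lemma fp_rel_words:
  assumes "\<And>i. i \<in> I \<Longrightarrow> group (G i)" and "(u, w) \<in> fp_rel I G"
  shows "u \<in> fp_words I G \<and> w \<in> fp_words I G"
  using assms(2)
proof induction
  case (one u w i) then show ?case using assms(1)[of i] by (auto simp: group.is_monoid monoid.one_closed)
next
  case (mult u w i a b) then show ?case using assms(1)[of i] by (auto simp: group.is_monoid monoid.m_closed)
qed auto

lemma equiv_fp_rel:
  assumes "\<And>i. i \<in> I \<Longrightarrow> group (G i)"
  shows "equiv (fp_words I G) (fp_rel I G)"
  using fp_rel_words[where I = I and G = G, OF assms]
  by (intro equivI) (auto simp: refl_on_def intro: fp_rel.intros symI transI)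

lemma fp_rel_context:
  assumes "(u, w) \<in> fp_rel I G" "x \<in> fp_words I G" "y \<in> fp_words I G"
  shows "(x @ u @ y, x @ w @ y) \<in> fp_rel I G"
  using assms(1)
proof induction
  case (refl w) then show ?case using assms by (auto intro!: fp_rel.refl)
next
  case (one u w i) then show ?case using assms fp_rel.one[of "x @ u" I G "w @ y" i] by auto
next
  case (mult u w i a b) then show ?case using assms fp_rel.mult[of "x @ u" I G "w @ y" i a b] by auto
qed (auto intro: fp_rel.sym fp_rel.trans)

lemma fp_rel_append:
  assumes "\<And>i. i \<in> I \<Longrightarrow> group (G i)"
  assumes "(u, u') \<in> fp_rel I G" "(w, w') \<in> fp_rel I G"
  shows "(u @ w, u' @ w') \<in> fp_rel I G"
  using fp_rel_context[OF assms(2), of "[]" w] fp_rel_context[OF assms(3), of u' "[]"]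
    fp_rel_words[OF assms(1) assms(2)] fp_rel_words[OF assms(1) assms(3)]
  by (auto intro: fp_rel.trans)

lemma fp_mult_class:
  assumes "\<And>i. i \<in> I \<Longrightarrow> group (G i)" "u \<in> fp_words I G" "w \<in> fp_words I G"
  shows "fp_rel I G `` {u} \<otimes>\<^bsub>free_product I G\<^esub> fp_rel I G `` {w} = fp_rel I G `` {u @ w}"
proof -
  have "fp_rel I G `` {x @ y} = fp_rel I G `` {u @ w}" if "(u, x) \<in> fp_rel I G" "(w, y) \<in> fp_rel I G" for x y
    using equiv_class_eq[OF equiv_fp_rel[OF assms(1)] fp_rel_append[OF assms(1) that]] by simp
  moreover have "(u, u) \<in> fp_rel I G" "(w, w) \<in> fp_rel I G" using assms by (auto intro: fp_rel.refl)
  ultimately show ?thesis 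
    unfolding free_product_def monoid.simps by (intro equalityI subsetI) (force, blast)
qed

lemma carrier_free_product: "carrier (free_product I G) = (\<lambda>w. fp_rel I G `` {w}) ` fp_words I G"
  by (auto simp: free_product_def quotient_def)

lemma one_free_product: "\<one>\<^bsub>free_product I G\<^esub> = fp_rel I G `` {[]}"
  by (simp add: free_product_def)

lemma group_free_product:
  assumes "\<And>i. i \<in> I \<Longrightarrow> group (G i)"
  shows "group (free_product I G)"
proof (rule groupI)
  fix x assume "x \<in> carrier (free_product I G)"
  then obtain w where w: "w \<in> fp_words I G" "x = fp_rel I G `` {w}"
    by (auto simp: carrier_free_product)
  from w(1) have "\<exists>v \<in> fp_words I G. (v @ w, []) \<in> fp_rel I G"
  proof (induction w)
    case Nil then show ?case by (intro bexI[of _ "[]"]) (auto intro: fp_rel.refl)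
  next
    case (Cons p w)
    obtain i a where p: "p = (i, a)" by force
    with Cons obtain v where v: "v \<in> fp_words I G" "(v @ w, []) \<in> fp_rel I G" by auto
    from Cons p have i: "i \<in> I" "a \<in> carrier (G i)" and wI: "w \<in> fp_words I G" by auto
    interpret Gi: group "G i" using assms i by auto
    have "(v @ [(i, inv\<^bsub>G i\<^esub> a), (i, a)] @ w, v @ [(i, inv\<^bsub>G i\<^esub> a \<otimes>\<^bsub>G i\<^esub> a)] @ w) \<in> fp_rel I G"
      using v i wI by (intro fp_rel.mult) auto
    moreover have "(v @ [(i, inv\<^bsub>G i\<^esub> a \<otimes>\<^bsub>G i\<^esub> a)] @ w, v @ w) \<in> fp_rel I G"
      using v i wI fp_rel.one[of v I G w i] by auto
    ultimately have "((v @ [(i, inv\<^bsub>G i\<^esub> a)]) @ p # w, []) \<in> fp_rel I G"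
      using v(2) p by (auto intro: fp_rel.trans)
    then show ?case using v i by (intro bexI[of _ "v @ [(i, inv\<^bsub>G i\<^esub> a)]"]) auto
  qed
  then obtain v where v: "v \<in> fp_words I G" "(v @ w, []) \<in> fp_rel I G" by auto
  have "fp_rel I G `` {v} \<otimes>\<^bsub>free_product I G\<^esub> x = \<one>\<^bsub>free_product I G\<^esub>"
    using v w equiv_class_eq[OF equiv_fp_rel[OF assms] v(2)]
    by (simp add: fp_mult_class[OF assms] one_free_product)
  then show "\<exists>y\<in>carrier (free_product I G). y \<otimes>\<^bsub>free_product I G\<^esub> x = \<one>\<^bsub>free_product I G\<^esub>"
    using v by (auto simp: carrier_free_product)
next
  note simps = carrier_free_product one_free_product fp_mult_class[OF assms]
  fix x y z
  assume "x \<in> carrier (free_product I G)" "y \<in> carrier (free_product I G)" "z \<in> carrier (free_product I G)"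
  then obtain u v w where "u \<in> fp_words I G" "x = fp_rel I G `` {u}"
    "v \<in> fp_words I G" "y = fp_rel I G `` {v}" "w \<in> fp_words I G" "z = fp_rel I G `` {w}"
    unfolding carrier_free_product by blast
  then show "x \<otimes>\<^bsub>free_product I G\<^esub> y \<otimes>\<^bsub>free_product I G\<^esub> z =
      x \<otimes>\<^bsub>free_product I G\<^esub> (y \<otimes>\<^bsub>free_product I G\<^esub> z)"
    by (simp add: simps)
next
  fix x y
  assume "x \<in> carrier (free_product I G)" "y \<in> carrier (free_product I G)"
  then obtain u v where "u \<in> fp_words I G" "x = fp_rel I G `` {u}"
    "v \<in> fp_words I G" "y = fp_rel I G `` {v}"
    unfolding carrier_free_product by blast
  then show "x \<otimes>\<^bsub>free_product I G\<^esub> y \<in> carrier (free_product I G)"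
    by (simp add: carrier_free_product fp_mult_class[OF assms] image_eqI[OF HOL.refl])
next
  show "\<one>\<^bsub>free_product I G\<^esub> \<in> carrier (free_product I G)"
    by (simp add: carrier_free_product one_free_product image_eqI[OF HOL.refl])
next
  fix x
  assume "x \<in> carrier (free_product I G)"
  then obtain u where "u \<in> fp_words I G" "x = fp_rel I G `` {u}"
    unfolding carrier_free_product by blast
  then show "\<one>\<^bsub>free_product I G\<^esub> \<otimes>\<^bsub>free_product I G\<^esub> x = x"
    by (simp add: one_free_product fp_mult_class[OF assms])
qed

lemma fp_incl_hom:
  assumes "\<And>i. i \<in> I \<Longrightarrow> group (G i)" "i \<in> I"
  shows "fp_incl I G i \<in> hom (G i) (free_product I G)"
proof (rule homI)
  show "fp_incl I G i a \<in> carrier (free_product I G)" if "a \<in> carrier (G i)" for a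
    using that assms by (auto simp: fp_incl_def carrier_free_product)
  show "fp_incl I G i (a \<otimes>\<^bsub>G i\<^esub> b) = fp_incl I G i a \<otimes>\<^bsub>free_product I G\<^esub> fp_incl I G i b"
    if "a \<in> carrier (G i)" "b \<in> carrier (G i)" for a b
    using that assms fp_rel.mult[of "[]" I G "[]" i a b] equiv_class_eq[OF equiv_fp_rel[where I = I and G = G, OF assms(1)]]
    by (auto simp add: fp_incl_def fp_mult_class[where I = I and G = G])
qed

lemma free_product_universal:
  assumes G: "\<And>i. i \<in> I \<Longrightarrow> group (G i)" and K: "group K"
    and f: "\<And>i. i \<in> I \<Longrightarrow> f i \<in> hom (G i) K"
  shows "\<exists>h \<in> hom (free_product I G) K. \<forall>i\<in>I. \<forall>a\<in>carrier (G i). h (fp_incl I G i a) = f i a"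
proof -
  interpret K: group K by fact
  define ev where "ev w = foldr (\<lambda>p x. f (fst p) (snd p) \<otimes>\<^bsub>K\<^esub> x) w \<one>\<^bsub>K\<^esub>" for w
  have fc: "f i a \<in> carrier K" if "i \<in> I" "a \<in> carrier (G i)" for i a
    using f[OF that(1)] that(2) by (auto simp: hom_def)
  have evs: "ev [] = \<one>\<^bsub>K\<^esub>" "ev (p # w) = f (fst p) (snd p) \<otimes>\<^bsub>K\<^esub> ev w" for p w
    by (auto simp: ev_def)
  have evc: "ev w \<in> carrier K" if "w \<in> fp_words I G" for w
    using that by (induction w) (auto simp: evs fc)
  have eva: "ev (u @ w) = ev u \<otimes>\<^bsub>K\<^esub> ev w" if "u \<in> fp_words I G" "w \<in> fp_words I G" for u w
    using that by (induction u) (auto simp: evs fc evc K.m_assoc)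
  have evr: "ev u = ev w" if "(u, w) \<in> fp_rel I G" for u w
    using that
  proof induction
    case (one u w i)
    have "f i \<one>\<^bsub>G i\<^esub> = \<one>\<^bsub>K\<^esub>" using hom_one[OF f[OF one(3)] G[OF one(3)] K] .
    then show ?case using one G[OF one(3)] by (simp add: eva evs evc monoid.one_closed group.is_monoid)
  next
    case (mult u w i a b)
    have "f i (a \<otimes>\<^bsub>G i\<^esub> b) = f i a \<otimes>\<^bsub>K\<^esub> f i b" using hom_mult[OF f[OF mult(3)]] mult by auto
    then show ?case using mult G[OF mult(3)]
      by (simp add: eva evs evc fc K.m_assoc monoid.m_closed group.is_monoid)
  qed auto
  define h where "h A = ev (SOME w. w \<in> A)" for A
  have hc: "h (fp_rel I G `` {w}) = ev w" if "w \<in> fp_words I G" for w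
    unfolding h_def using that fp_rel.refl[OF that] evr by (metis Image_singleton_iff someI_ex)
  show ?thesis
  proof (intro bexI[of _ h] ballI homI)
    show "h (fp_incl I G i a) = f i a" if "i \<in> I" "a \<in> carrier (G i)" for i a
      using that hc[of "[(i,a)]"] by (simp add: fp_incl_def evs fc)
  next
    fix x assume "x \<in> carrier (free_product I G)"
    then obtain u where "u \<in> fp_words I G" "x = fp_rel I G `` {u}"
      unfolding carrier_free_product by blast
    then show "h x \<in> carrier K" by (simp add: hc evc)
  next
    fix x y
    assume "x \<in> carrier (free_product I G)" "y \<in> carrier (free_product I G)"
    then obtain u v where "u \<in> fp_words I G" "x = fp_rel I G `` {u}"
      "v \<in> fp_words I G" "y = fp_rel I G `` {v}"
      unfolding carrier_free_product by blast
    then show "h (x \<otimes>\<^bsub>free_product I G\<^esub> y) = h x \<otimes>\<^bsub>K\<^esub> h y"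
      by (simp add: hc evc fp_mult_class[OF G] eva)
  qed
qed


section \<open>Graph products\<close>

definition normal_closure :: "('a, 'm) monoid_scheme \<Rightarrow> 'a set \<Rightarrow> 'a set"
  where "normal_closure F S = \<Inter>{N. N \<lhd> F \<and> S \<subseteq> N}"

lemma normal_closure_normal:
  assumes "group F" "S \<subseteq> carrier F"
  shows "normal_closure F S \<lhd> F"
proof -
  interpret F: group F by fact
  have c: "carrier F \<in> {N. N \<lhd> F \<and> S \<subseteq> N}"
    using assms by (auto intro!: F.normal_invI F.subgroup_self)
  show ?thesis
  proof (rule F.normal_invI)
    show "subgroup (normal_closure F S) F" unfolding normal_closure_def
      using c by (intro F.subgroups_Inter) (auto dest: normal_imp_subgroup)
    show "g \<otimes>\<^bsub>F\<^esub> h \<otimes>\<^bsub>F\<^esub> inv\<^bsub>F\<^esub> g \<in> normal_closure F S"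
      if "g \<in> carrier F" "h \<in> normal_closure F S" for g h
      using that by (auto simp: normal_closure_def normal.inv_op_closed2)
  qed
qed

definition commutator :: "('a, 'm) monoid_scheme \<Rightarrow> 'a \<Rightarrow> 'a \<Rightarrow> 'a"
  where "commutator F x y = x \<otimes>\<^bsub>F\<^esub> y \<otimes>\<^bsub>F\<^esub> inv\<^bsub>F\<^esub> x \<otimes>\<^bsub>F\<^esub> inv\<^bsub>F\<^esub> y"

text \<open>
  A simplicial graph is a \<^locale>\<open>pair_bidirected_digraph\<close>: a possibly infinite vertex set with a
  symmetric irreflexive adjacency relation \<^term>\<open>parcs \<Gamma>\<close> on it.
\<close>

definition graph_product ::
  "'v pair_pre_digraph \<Rightarrow> ('v \<Rightarrow> ('a, 'm) monoid_scheme) \<Rightarrow> ('v \<times> 'a) list set set monoid"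
  where "graph_product \<Gamma> G =
    free_product (pverts \<Gamma>) G Mod
      normal_closure (free_product (pverts \<Gamma>) G)
        {commutator (free_product (pverts \<Gamma>) G)
            (fp_incl (pverts \<Gamma>) G u g) (fp_incl (pverts \<Gamma>) G v h) | u v g h.
          (u, v) \<in> parcs \<Gamma> \<and> g \<in> carrier (G u) \<and> h \<in> carrier (G v)}"

lemma group_graph_product:
  assumes "pair_bidirected_digraph \<Gamma>" "\<And>v. v \<in> pverts \<Gamma> \<Longrightarrow> group (G v)"
  shows "group (graph_product \<Gamma> G)"
proof -
  interpret pair_bidirected_digraph \<Gamma> by fact
  interpret F: group "free_product (pverts \<Gamma>) G" by (rule group_free_product) (use assms in auto)
  have "fp_incl (pverts \<Gamma>) G v g \<in> carrier (free_product (pverts \<Gamma>) G)"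
    if "v \<in> pverts \<Gamma>" "g \<in> carrier (G v)" for v g
    using fp_incl_hom[of "pverts \<Gamma>" G v] assms(2) that by (auto simp: hom_def)
  then show ?thesis unfolding graph_product_def
    by (intro normal.factorgroup_is_group normal_closure_normal F.is_group)
      (auto simp: commutator_def intro!: F.m_closed dest: in_arcsD1 in_arcsD2)
qed


section \<open>Chromatic number\<close>

definition proper_colouring :: "'v pair_pre_digraph \<Rightarrow> nat \<Rightarrow> ('v \<Rightarrow> nat) \<Rightarrow> bool"
  where "proper_colouring \<Gamma> k c \<longleftrightarrow>
    c \<in> pverts \<Gamma> \<rightarrow> {..<k} \<and> (\<forall>(u, v) \<in> parcs \<Gamma>. c u \<noteq> c v)"

text \<open>The value is \<open>\<infinity>\<close> if no finite number of colours suffices.\<close>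

definition chromatic_number :: "'v pair_pre_digraph \<Rightarrow> enat"
  where "chromatic_number \<Gamma> = Inf {enat k | k. \<exists>c. proper_colouring \<Gamma> k c}"

lemma chromatic_number_eq_enat_iff:
  "chromatic_number \<Gamma> = enat n \<longleftrightarrow>
    (\<exists>c. proper_colouring \<Gamma> n c) \<and> (\<forall>k<n. \<nexists>c. proper_colouring \<Gamma> k c)"
proof -
  let ?A = "{enat k | k. \<exists>c. proper_colouring \<Gamma> k c}"
  show ?thesis
  proof
    assume a: "chromatic_number \<Gamma> = enat n"
    then have "?A \<noteq> {}" unfolding chromatic_number_def Inf_enat_def by (metis enat.distinct(1) infinity_enat_def)
    then have "Inf ?A \<in> ?A" unfolding Inf_enat_def using LeastI_ex[of "\<lambda>x. x \<in> ?A"] by (simp only: if_False) blast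
    with a have "\<exists>c. proper_colouring \<Gamma> n c" by (auto simp: chromatic_number_def)
    moreover have "n \<le> k" if "proper_colouring \<Gamma> k c" for k c
    proof -
      have "Inf ?A \<le> enat k" using that by (intro Inf_lower) auto
      then show ?thesis using a by (simp add: chromatic_number_def)
    qed
    ultimately show "(\<exists>c. proper_colouring \<Gamma> n c) \<and> (\<forall>k<n. \<nexists>c. proper_colouring \<Gamma> k c)"
      by (meson not_le)
  next
    assume "(\<exists>c. proper_colouring \<Gamma> n c) \<and> (\<forall>k<n. \<nexists>c. proper_colouring \<Gamma> k c)"
    then show "chromatic_number \<Gamma> = enat n" unfolding chromatic_number_def
      by (intro antisym Inf_lower Inf_greatest) (auto simp: not_less[symmetric])
  qed
qed


section \<open>Free products of copies of given groups\<close>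

text \<open>
  The indices of the factors are taken from \<open>'v \<times> 'q\<close>, where \<open>'q\<close> is the type of the elements
  of \<open>Q\<close>. This is no restriction: trivial factors can be omitted, and the index of a nontrivial
  factor is determined by the image in \<open>Q\<close> of any of its nontrivial elements.
  The condition \<^prop>\<open>group (H i)\<close> is needed because \<open>\<cong>\<close> only concerns the carriers and the
  multiplications and says nothing about the component \<open>one\<close> of the record.
\<close>

definition free_product_of_copies ::
  "('q, 'n) monoid_scheme \<Rightarrow> 'v set \<Rightarrow> ('v \<Rightarrow> ('a, 'm) monoid_scheme) \<Rightarrow> bool"
  where "free_product_of_copies Q V G \<longleftrightarrow>
    (\<exists>(I :: ('v \<times> 'q) set) (H :: 'v \<times> 'q \<Rightarrow> 'a monoid).
      (\<forall>i\<in>I. group (H i) \<and> (\<exists>v\<in>V. H i \<cong> G v)) \<and> Q \<cong> free_product I H)"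

end

theory Submission
  imports Defs
begin

text \<open>
  Let \<open>GP\<close> be the graph product and let \<open>\<rho>\<^sub>S\<close> be its retraction onto the part spanned by a set \<open>S\<close>
  of vertices: the endomorphism that fixes the vertex groups in \<open>S\<close> and kills the others. Given a
  proper colouring \<open>c\<close> with \<open>n\<close> colours, the series is formed by the kernels of the retractions for
  \<open>S = {v. c v < i}\<close>. It starts at \<open>GP\<close>, where everything is killed, ends at the trivial group,
  where nothing is killed, and decreases because \<open>\<rho>\<^sub>S \<circ> \<rho>\<^sub>T = \<rho>\<^sub>S\<close> for \<open>S \<subseteq> T\<close>.

  Passing from one term to the next adds to \<open>W = {v. c v < i - 1}\<close> one colour class \<open>U\<close>, a set of
  pairwise nonadjacent vertices. So all the content is that \<open>ker \<rho>\<^sub>W / ker \<rho>\<^bsub>W \<union> U\<^esub>\<close> is a free product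
  of copies of the \<open>G u\<close> with \<open>u \<in> U\<close> (\<open>kernel_quotient_free_product\<close>). Put \<open>A = \<rho>\<^sub>W(GP)\<close>, and for
  \<open>u \<in> U\<close> let \<open>L u \<subseteq> A\<close> be the subgroup generated by the vertex groups of the neighbours of \<open>u\<close>
  in \<open>W\<close>. Conjugating \<open>G u\<close> by \<open>x \<in> A\<close> gives a subgroup that depends only on the coset \<open>x L u\<close>,
  since \<open>L u\<close> commutes with \<open>G u\<close>. Let \<open>P\<close> be the abstract free product of one copy of \<open>G u\<close> for each
  pair \<open>(u, x L u)\<close>. The group \<open>A\<close> permutes the factors of \<open>P\<close> by translation of cosets, and the
  claim is that the part of \<open>GP\<close> over \<open>W \<union> U\<close> is the semidirect product of \<open>P\<close> and \<open>A\<close>.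

  Both directions come from universal properties. The defining relations of \<open>GP\<close> hold in the
  semidirect product: the factor of \<open>u\<close> at the trivial coset is fixed by the vertex group of a
  neighbour \<open>v \<in> W\<close> because that group lies in \<open>L u\<close>, and there are no relations between different
  vertices of \<open>U\<close>. This gives \<open>\<psi>\<close> from \<open>GP\<close> to the semidirect product; conversely, evaluating
  \<open>(p, a)\<close> in \<open>GP\<close> gives a homomorphism \<open>\<theta>\<close> back. On generators one checks that
  \<open>\<theta> \<circ> \<psi> = \<rho>\<^bsub>W \<union> U\<^esub>\<close> and \<open>\<psi> \<circ> \<rho>\<^bsub>W \<union> U\<^esub> = \<psi>\<close>, so that \<open>\<psi>\<close> has the same kernel as \<open>\<rho>\<^bsub>W \<union> U\<^esub>\<close>, that the
  \<open>A\<close>-component of \<open>\<psi>\<close> is \<open>\<rho>\<^sub>W\<close>, and that \<open>\<psi>\<close> undoes the evaluation of \<open>P\<close>. Hence the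
  \<open>P\<close>-component of \<open>\<psi>\<close> is, on \<open>ker \<rho>\<^sub>W\<close>, a homomorphism onto \<open>P\<close> with kernel \<open>ker \<rho>\<^bsub>W \<union> U\<^esub>\<close>.
\<close>

section \<open>Homomorphisms out of free products\<close>

text \<open>The uniqueness half of the universal property: the factors generate the free product.\<close>

lemma free_product_hom_eqI:
  assumes G: "\<And>i. i \<in> I \<Longrightarrow> group (G i)" and K: "group K"
    and h: "h \<in> hom (free_product I G) K" and h': "h' \<in> hom (free_product I G) K"
    and eq: "\<And>i a. i \<in> I \<Longrightarrow> a \<in> carrier (G i) \<Longrightarrow> h (fp_incl I G i a) = h' (fp_incl I G i a)"
    and x: "x \<in> carrier (free_product I G)"
  shows "h x = h' x"
proof -
  have F: "group (free_product I G)" using G by (rule group_free_product)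
  obtain w where w: "w \<in> fp_words I G" "x = fp_rel I G `` {w}"
    using x by (auto simp: carrier_free_product)
  from w(1) have "h (fp_rel I G `` {w}) = h' (fp_rel I G `` {w})"
  proof (induction w)
    case Nil
    then show ?case
      using hom_one[OF h F K] hom_one[OF h' F K] by (simp add: one_free_product)
  next
    case (Cons p w)
    obtain i a where p: "p = (i, a)" by force
    have ia: "i \<in> I" "a \<in> carrier (G i)" "w \<in> fp_words I G" using Cons.prems p by auto
    have split: "fp_rel I G `` {p # w} = fp_incl I G i a \<otimes>\<^bsub>free_product I G\<^esub> fp_rel I G `` {w}"
      using fp_mult_class[where I = I and G = G and u = "[p]" and w = w, OF G] ia p by (simp add: fp_incl_def)
    have c: "fp_incl I G i a \<in> carrier (free_product I G)"
      "fp_rel I G `` {w} \<in> carrier (free_product I G)"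
      using ia by (auto simp: carrier_free_product fp_incl_def)
    show ?case
      unfolding split using hom_mult[OF h c] hom_mult[OF h' c] eq[OF ia(1,2)] Cons.IH[OF ia(3)] by simp
  qed
  with w show ?thesis by simp
qed

text \<open>
  A group that permutes the factors of a free product acts on the free product by
  automorphisms. The factors along an orbit are required to be equal, not just isomorphic, so that
  a letter can be moved without being changed and the action laws hold on the nose.
\<close>

lemma free_product_index_action:
  fixes A :: "('b, 'm) monoid_scheme" and H :: "'i \<Rightarrow> ('a, 'n) monoid_scheme"
  assumes A: "group A" and H: "\<And>i. i \<in> I \<Longrightarrow> group (H i)"
    and act: "\<And>a i. a \<in> carrier A \<Longrightarrow> i \<in> I \<Longrightarrow> act a i \<in> I"
    and inv: "\<And>a i. a \<in> carrier A \<Longrightarrow> i \<in> I \<Longrightarrow> H (act a i) = H i"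
    and mult: "\<And>a b i. a \<in> carrier A \<Longrightarrow> b \<in> carrier A \<Longrightarrow> i \<in> I \<Longrightarrow>
      act (a \<otimes>\<^bsub>A\<^esub> b) i = act a (act b i)"
    and one: "\<And>i. i \<in> I \<Longrightarrow> act \<one>\<^bsub>A\<^esub> i = i"
  obtains \<alpha> where
    "\<And>a. a \<in> carrier A \<Longrightarrow> \<alpha> a \<in> hom (free_product I H) (free_product I H)"
    "\<And>a i g. a \<in> carrier A \<Longrightarrow> i \<in> I \<Longrightarrow> g \<in> carrier (H i) \<Longrightarrow>
      \<alpha> a (fp_incl I H i g) = fp_incl I H (act a i) g"
    "\<And>a b x. a \<in> carrier A \<Longrightarrow> b \<in> carrier A \<Longrightarrow> x \<in> carrier (free_product I H) \<Longrightarrow>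
      \<alpha> (a \<otimes>\<^bsub>A\<^esub> b) x = \<alpha> a (\<alpha> b x)"
    "\<And>x. x \<in> carrier (free_product I H) \<Longrightarrow> \<alpha> \<one>\<^bsub>A\<^esub> x = x"
proof -
  interpret A: group A by fact
  let ?P = "free_product I H"
  have P: "group ?P" using H by (rule group_free_product)
  have "\<forall>a\<in>carrier A. \<exists>h\<in>hom ?P ?P. \<forall>i\<in>I. \<forall>g\<in>carrier (H i).
      h (fp_incl I H i g) = fp_incl I H (act a i) g"
  proof
    fix a assume a: "a \<in> carrier A"
    have "fp_incl I H (act a i) \<in> hom (H i) ?P" if "i \<in> I" for i
      using fp_incl_hom[where I = I and G = H and i = "act a i", OF H act[OF a that]] inv[OF a that] by simp
    then show "\<exists>h\<in>hom ?P ?P. \<forall>i\<in>I. \<forall>g\<in>carrier (H i).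
        h (fp_incl I H i g) = fp_incl I H (act a i) g"
      using free_product_universal[where I = I and G = H and K = ?P, OF H P] by simp
  qed
  then obtain \<alpha> where hom: "\<And>a. a \<in> carrier A \<Longrightarrow> \<alpha> a \<in> hom ?P ?P"
    and gen: "\<And>a i g. a \<in> carrier A \<Longrightarrow> i \<in> I \<Longrightarrow> g \<in> carrier (H i) \<Longrightarrow>
      \<alpha> a (fp_incl I H i g) = fp_incl I H (act a i) g"
    unfolding Bex_def by (metis (no_types) bchoice)
  have comp: "\<alpha> (a \<otimes>\<^bsub>A\<^esub> b) x = \<alpha> a (\<alpha> b x)"
    if a: "a \<in> carrier A" and b: "b \<in> carrier A" and x: "x \<in> carrier ?P" for a b x
  proof -
    have "\<alpha> (a \<otimes>\<^bsub>A\<^esub> b) x = (\<alpha> a \<circ> \<alpha> b) x"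
    proof (rule free_product_hom_eqI[where I = I and G = H and K = ?P, OF H P _ _ _ x])
      show "\<alpha> a \<circ> \<alpha> b \<in> hom ?P ?P" using hom_compose[OF hom[OF b] hom[OF a]] .
    qed (use a b in \<open>auto simp: gen act inv mult hom\<close>)
    then show ?thesis by simp
  qed
  have unit: "\<alpha> \<one>\<^bsub>A\<^esub> x = x" if x: "x \<in> carrier ?P" for x
  proof -
    have "\<alpha> \<one>\<^bsub>A\<^esub> x = id x"
    proof (rule free_product_hom_eqI[where I = I and G = H and K = ?P, OF H P _ _ _ x])
      show "id \<in> hom ?P ?P" by (simp add: hom_def)
    qed (auto simp: gen one hom)
    then show ?thesis by simp
  qed
  show thesis by (rule that[OF hom gen comp unit])
qed

section \<open>Semidirect products\<close>

definition semidirect_product ::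
  "('b, 'm) monoid_scheme \<Rightarrow> ('c, 'n) monoid_scheme \<Rightarrow> ('c \<Rightarrow> 'b \<Rightarrow> 'b) \<Rightarrow> ('b \<times> 'c) monoid"
  where "semidirect_product N A \<alpha> =
    \<lparr>carrier = carrier N \<times> carrier A,
     monoid.mult = (\<lambda>(n, a) (m, b). (n \<otimes>\<^bsub>N\<^esub> \<alpha> a m, a \<otimes>\<^bsub>A\<^esub> b)),
     one = (\<one>\<^bsub>N\<^esub>, \<one>\<^bsub>A\<^esub>)\<rparr>"

lemma semidirect_product_simps [simp]:
  "carrier (semidirect_product N A \<alpha>) = carrier N \<times> carrier A"
  "(n, a) \<otimes>\<^bsub>semidirect_product N A \<alpha>\<^esub> (m, b) = (n \<otimes>\<^bsub>N\<^esub> \<alpha> a m, a \<otimes>\<^bsub>A\<^esub> b)"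
  "\<one>\<^bsub>semidirect_product N A \<alpha>\<^esub> = (\<one>\<^bsub>N\<^esub>, \<one>\<^bsub>A\<^esub>)"
  by (auto simp: semidirect_product_def)

lemma group_semidirect_product:
  assumes N: "group N" and A: "group A"
    and hom: "\<And>a. a \<in> carrier A \<Longrightarrow> \<alpha> a \<in> hom N N"
    and mult: "\<And>a b n. a \<in> carrier A \<Longrightarrow> b \<in> carrier A \<Longrightarrow> n \<in> carrier N \<Longrightarrow>
      \<alpha> (a \<otimes>\<^bsub>A\<^esub> b) n = \<alpha> a (\<alpha> b n)"
    and one: "\<And>n. n \<in> carrier N \<Longrightarrow> \<alpha> \<one>\<^bsub>A\<^esub> n = n"
  shows "group (semidirect_product N A \<alpha>)"
proof -
  interpret N: group N by fact
  interpret A: group A by fact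
  have cl: "\<alpha> a n \<in> carrier N" if "a \<in> carrier A" "n \<in> carrier N" for a n
    using hom[OF that(1)] that(2) by (auto simp: hom_def)
  have m: "\<alpha> a (n \<otimes>\<^bsub>N\<^esub> k) = \<alpha> a n \<otimes>\<^bsub>N\<^esub> \<alpha> a k"
    if "a \<in> carrier A" "n \<in> carrier N" "k \<in> carrier N" for a n k
    using hom[OF that(1)] that(2,3) by (auto simp: hom_def)
  show ?thesis
  proof (rule groupI)
    fix x assume "x \<in> carrier (semidirect_product N A \<alpha>)"
    then obtain n a where x: "x = (n, a)" "n \<in> carrier N" "a \<in> carrier A" by auto
    let ?y = "(\<alpha> (inv\<^bsub>A\<^esub> a) (inv\<^bsub>N\<^esub> n), inv\<^bsub>A\<^esub> a)"
    have "\<alpha> (inv\<^bsub>A\<^esub> a) (inv\<^bsub>N\<^esub> n) \<otimes>\<^bsub>N\<^esub> \<alpha> (inv\<^bsub>A\<^esub> a) n = \<one>\<^bsub>N\<^esub>"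
      using x m[of "inv\<^bsub>A\<^esub> a" "inv\<^bsub>N\<^esub> n" n] hom_one[OF hom N N, of "inv\<^bsub>A\<^esub> a"] by simp
    then show "\<exists>y\<in>carrier (semidirect_product N A \<alpha>).
        y \<otimes>\<^bsub>semidirect_product N A \<alpha>\<^esub> x = \<one>\<^bsub>semidirect_product N A \<alpha>\<^esub>"
      using x by (intro bexI[of _ ?y]) (auto simp: cl)
  qed (auto simp: cl m mult one N.m_assoc A.m_assoc)
qed

section \<open>Conjugation, commutators and normal closures\<close>

lemma (in group) conjugation_hom:
  assumes a: "a \<in> carrier G"
  shows "(\<lambda>x. a \<otimes> x \<otimes> inv a) \<in> hom G G"
proof (rule homI)
  fix x y assume xy: "x \<in> carrier G" "y \<in> carrier G"
  then have "a \<otimes> x \<otimes> inv a \<otimes> (a \<otimes> y \<otimes> inv a) = a \<otimes> x \<otimes> (inv a \<otimes> a) \<otimes> y \<otimes> inv a"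
    using a by (simp only: m_assoc m_closed inv_closed)
  then show "a \<otimes> (x \<otimes> y) \<otimes> inv a = a \<otimes> x \<otimes> inv a \<otimes> (a \<otimes> y \<otimes> inv a)"
    using a xy by (simp add: m_assoc)
qed (use a in simp)

lemma normal_closure_least:
  "N \<lhd> F \<Longrightarrow> S \<subseteq> N \<Longrightarrow> normal_closure F S \<subseteq> N"
  by (auto simp: normal_closure_def)

lemma normal_closure_superset: "S \<subseteq> normal_closure F S"
  by (auto simp: normal_closure_def)

lemma (in group) commutator_eq_one_iff:
  assumes "x \<in> carrier G" "y \<in> carrier G"
  shows "commutator G x y = \<one> \<longleftrightarrow> x \<otimes> y = y \<otimes> x"
proof -
  have "commutator G x y = (x \<otimes> y) \<otimes> inv (y \<otimes> x)"
    using assms by (simp add: commutator_def inv_mult_group m_assoc)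
  then show ?thesis using assms by (metis inv_equality inv_inv inv_closed m_closed r_inv)
qed

lemma (in group_hom) hom_commutator:
  assumes "x \<in> carrier G" "y \<in> carrier G"
  shows "h (commutator G x y) = commutator H (h x) (h y)"
  using assms by (simp add: commutator_def)

section \<open>Homomorphisms out of graph products\<close>

locale graph_of_groups =
  fixes \<Gamma> :: "'v pair_pre_digraph" and G :: "'v \<Rightarrow> ('a, 'm) monoid_scheme"
  assumes graph: "pair_bidirected_digraph \<Gamma>"
    and vertex_group: "\<And>v. v \<in> pverts \<Gamma> \<Longrightarrow> group (G v)"
begin

abbreviation "V \<equiv> pverts \<Gamma>"
abbreviation "GP \<equiv> graph_product \<Gamma> G"

definition "relators =
  {commutator (free_product V G) (fp_incl V G u g) (fp_incl V G v h) | u v g h.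
    (u, v) \<in> parcs \<Gamma> \<and> g \<in> carrier (G u) \<and> h \<in> carrier (G v)}"

definition incl :: "'v \<Rightarrow> 'a \<Rightarrow> ('v \<times> 'a) list set set"
  where "incl v g =
    normal_closure (free_product V G) relators #>\<^bsub>free_product V G\<^esub> fp_incl V G v g"

lemma GP_eq: "GP = free_product V G Mod normal_closure (free_product V G) relators"
  by (simp add: graph_product_def relators_def)

lemma edge_in_V: "(u, v) \<in> parcs \<Gamma> \<Longrightarrow> u \<in> V \<and> v \<in> V"
proof -
  interpret pair_bidirected_digraph \<Gamma> by (rule graph)
  show "(u, v) \<in> parcs \<Gamma> \<Longrightarrow> u \<in> V \<and> v \<in> V" using in_arcsD1 in_arcsD2 by blast
qed

lemma edge_sym: "(u, v) \<in> parcs \<Gamma> \<Longrightarrow> (v, u) \<in> parcs \<Gamma>"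
proof -
  interpret pair_bidirected_digraph \<Gamma> by (rule graph)
  show "(u, v) \<in> parcs \<Gamma> \<Longrightarrow> (v, u) \<in> parcs \<Gamma>" by (rule arcs_symmetric)
qed

sublocale F: group "free_product V G"
  using vertex_group by (rule group_free_product)

sublocale GP: group GP
  using graph vertex_group by (rule group_graph_product)

lemma fp_incl_closed:
  "v \<in> V \<Longrightarrow> g \<in> carrier (G v) \<Longrightarrow> fp_incl V G v g \<in> carrier (free_product V G)"
  using fp_incl_hom[of V G v] vertex_group by (auto simp: hom_def)

lemma relators_subset: "relators \<subseteq> carrier (free_product V G)"
  using edge_in_V by (fastforce simp: relators_def commutator_def fp_incl_closed)

lemma normal_relators: "normal_closure (free_product V G) relators \<lhd> free_product V G"
  using F.is_group relators_subset by (rule normal_closure_normal)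

lemma quotient_hom:
  "(#>\<^bsub>free_product V G\<^esub>) (normal_closure (free_product V G) relators) \<in> hom (free_product V G) GP"
  unfolding GP_eq using normal.r_coset_hom_Mod[OF normal_relators] .

lemma incl_hom: "v \<in> V \<Longrightarrow> incl v \<in> hom (G v) GP"
  using hom_compose[OF fp_incl_hom[of V G v] quotient_hom] vertex_group
  by (simp add: incl_def[abs_def] comp_def)

lemma incl_closed [simp]: "v \<in> V \<Longrightarrow> g \<in> carrier (G v) \<Longrightarrow> incl v g \<in> carrier GP"
  using incl_hom by (auto simp: hom_def)

lemma incl_commute:
  assumes uv: "(u, v) \<in> parcs \<Gamma>" and g: "g \<in> carrier (G u)" and h: "h \<in> carrier (G v)"
  shows "incl u g \<otimes>\<^bsub>GP\<^esub> incl v h = incl v h \<otimes>\<^bsub>GP\<^esub> incl u g"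
proof -
  let ?N = "normal_closure (free_product V G) relators"
  interpret q: group_hom "free_product V G" GP "(#>\<^bsub>free_product V G\<^esub>) ?N"
    by unfold_locales (rule quotient_hom)
  have V: "u \<in> V" "v \<in> V" using edge_in_V[OF uv] by auto
  have "commutator (free_product V G) (fp_incl V G u g) (fp_incl V G v h) \<in> ?N"
    using normal_closure_superset[of relators "free_product V G"] uv g h by (force simp: relators_def)
  then have "?N #>\<^bsub>free_product V G\<^esub> commutator (free_product V G) (fp_incl V G u g) (fp_incl V G v h)
      = \<one>\<^bsub>GP\<^esub>"
    using subgroup.rcos_const[OF normal_imp_subgroup[OF normal_relators] F.is_group]
    by (simp add: GP_eq)
  then have "commutator GP (incl u g) (incl v h) = \<one>\<^bsub>GP\<^esub>"
    using V g h by (simp add: q.hom_commutator fp_incl_closed incl_def)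
  then show ?thesis using V g h by (simp add: GP.commutator_eq_one_iff)
qed

text \<open>
  The next two lemmas are the universal property of the graph product. Together with \<open>incl_hom\<close>
  and \<open>incl_commute\<close> they replace all further recourse to words and quotients.
\<close>

lemma hom_exists:
  assumes K: "group K"
    and f: "\<And>v. v \<in> V \<Longrightarrow> f v \<in> hom (G v) K"
    and comm: "\<And>u v g h. (u, v) \<in> parcs \<Gamma> \<Longrightarrow> g \<in> carrier (G u) \<Longrightarrow> h \<in> carrier (G v) \<Longrightarrow>
      f u g \<otimes>\<^bsub>K\<^esub> f v h = f v h \<otimes>\<^bsub>K\<^esub> f u g"
  obtains h where "h \<in> hom GP K" "\<And>v g. v \<in> V \<Longrightarrow> g \<in> carrier (G v) \<Longrightarrow> h (incl v g) = f v g"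
proof -
  interpret K: group K by fact
  obtain k where k: "k \<in> hom (free_product V G) K"
    and kf: "\<And>v g. v \<in> V \<Longrightarrow> g \<in> carrier (G v) \<Longrightarrow> k (fp_incl V G v g) = f v g"
    using free_product_universal[of V G K f] vertex_group K f by auto
  interpret k: group_hom "free_product V G" K k by unfold_locales (rule k)
  have fc: "f v g \<in> carrier K" if "v \<in> V" "g \<in> carrier (G v)" for v g
    using f[OF that(1)] that(2) by (auto simp: hom_def)
  have "k (commutator (free_product V G) (fp_incl V G u g) (fp_incl V G v h)) = \<one>\<^bsub>K\<^esub>"
    if "(u, v) \<in> parcs \<Gamma>" "g \<in> carrier (G u)" "h \<in> carrier (G v)" for u v g h
    using that edge_in_V[OF that(1)] comm[OF that]
    by (simp add: k.hom_commutator fp_incl_closed kf K.commutator_eq_one_iff fc)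
  then have "relators \<subseteq> kernel (free_product V G) K k"
    using relators_subset unfolding kernel_def by (fastforce simp: relators_def)
  then have "normal_closure (free_product V G) relators \<subseteq> kernel (free_product V G) K k"
    by (intro normal_closure_least k.normal_kernel)
  from k.FactGroup_universal_kernel[OF normal_relators this] obtain h where
    h: "h \<in> hom GP K" "\<And>x. x \<in> carrier (free_product V G) \<Longrightarrow>
      h (normal_closure (free_product V G) relators #>\<^bsub>free_product V G\<^esub> x) = k x"
    unfolding GP_eq by blast
  show thesis
    by (rule that[OF h(1)]) (simp add: incl_def h(2) fp_incl_closed kf)
qed

lemma hom_eqI:
  assumes K: "group K" and h: "h \<in> hom GP K" and h': "h' \<in> hom GP K"
    and eq: "\<And>v g. v \<in> V \<Longrightarrow> g \<in> carrier (G v) \<Longrightarrow> h (incl v g) = h' (incl v g)"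
    and x: "x \<in> carrier GP"
  shows "h x = h' x"
proof -
  let ?q = "(#>\<^bsub>free_product V G\<^esub>) (normal_closure (free_product V G) relators)"
  obtain y where y: "y \<in> carrier (free_product V G)" "x = ?q y"
    using x by (auto simp: GP_eq FactGroup_def RCOSETS_def)
  have "(h \<circ> ?q) y = (h' \<circ> ?q) y"
    using vertex_group K hom_compose[OF quotient_hom h] hom_compose[OF quotient_hom h'] _ y(1)
    by (rule free_product_hom_eqI) (use eq in \<open>auto simp: incl_def\<close>)
  then show ?thesis using y by simp
qed

section \<open>Retractions onto full subgraphs\<close>

text \<open>
  The image of the retraction for \<open>S\<close> plays the role of the graph product over the full subgraph
  on \<open>S\<close>. Realising it inside the ambient graph product keeps all groups in one type.
\<close>

definition retraction :: "'v set \<Rightarrow> ('v \<times> 'a) list set set \<Rightarrow> ('v \<times> 'a) list set set"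
  where "retraction S = (SOME h. h \<in> hom GP GP \<and>
    (\<forall>v\<in>V. \<forall>g\<in>carrier (G v). h (incl v g) = (if v \<in> S then incl v g else \<one>\<^bsub>GP\<^esub>)))"

lemma retraction_hom: "retraction S \<in> hom GP GP" (is ?hom)
  and retraction_incl: "v \<in> V \<Longrightarrow> g \<in> carrier (G v) \<Longrightarrow>
    retraction S (incl v g) = (if v \<in> S then incl v g else \<one>\<^bsub>GP\<^esub>)"
proof -
  let ?f = "\<lambda>v g. if v \<in> S then incl v g else \<one>\<^bsub>GP\<^esub>"
  obtain h where "h \<in> hom GP GP" "\<And>v g. v \<in> V \<Longrightarrow> g \<in> carrier (G v) \<Longrightarrow> h (incl v g) = ?f v g"
  proof (rule hom_exists[where K = GP and f = ?f])
    show "?f v \<in> hom (G v) GP" if "v \<in> V" for v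
      using incl_hom[OF that] by (auto simp: hom_def)
    show "?f u g \<otimes>\<^bsub>GP\<^esub> ?f v h = ?f v h \<otimes>\<^bsub>GP\<^esub> ?f u g"
      if "(u, v) \<in> parcs \<Gamma>" "g \<in> carrier (G u)" "h \<in> carrier (G v)" for u v g h
      using incl_commute[OF that] edge_in_V[OF that(1)] that by auto
  qed (use GP.is_group in auto)
  then have "\<exists>h. h \<in> hom GP GP \<and> (\<forall>v\<in>V. \<forall>g\<in>carrier (G v). h (incl v g) = ?f v g)"
    by auto
  from someI_ex[OF this] show ?hom
    and "v \<in> V \<Longrightarrow> g \<in> carrier (G v) \<Longrightarrow> retraction S (incl v g) = ?f v g"
    unfolding retraction_def[symmetric] by auto
qed

sublocale retraction: group_hom GP GP "retraction S" for S
  by unfold_locales (rule retraction_hom)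

lemma retraction_retraction:
  assumes x: "x \<in> carrier GP"
  shows "retraction S (retraction T x) = retraction (S \<inter> T) x"
proof -
  have "(retraction S \<circ> retraction T) x = retraction (S \<inter> T) x"
    using GP.is_group hom_compose[OF retraction_hom retraction_hom] retraction_hom _ x
    by (rule hom_eqI) (simp add: retraction_incl)
  then show ?thesis by simp
qed

lemma retraction_all: 
  assumes "V \<subseteq> S" and x: "x \<in> carrier GP"
  shows "retraction S x = x"
proof -
  have "retraction S x = id x"
    using GP.is_group retraction_hom _ _ x
    by (rule hom_eqI) (use assms in \<open>auto simp: retraction_incl hom_def\<close>)
  then show ?thesis by simp
qed

lemma retraction_none:
  assumes "V \<inter> S = {}" and x: "x \<in> carrier GP"
  shows "retraction S x = \<one>\<^bsub>GP\<^esub>"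
proof -
  have "retraction S x = (\<lambda>_. \<one>\<^bsub>GP\<^esub>) x"
    using GP.is_group retraction_hom _ _ x
    by (rule hom_eqI) (use assms in \<open>auto simp: retraction_incl hom_def\<close>)
  then show ?thesis by simp
qed

lemma kernel_retraction_antimono:
  assumes "S \<subseteq> T"
  shows "kernel GP GP (retraction T) \<subseteq> kernel GP GP (retraction S)"
proof
  fix x assume x: "x \<in> kernel GP GP (retraction T)"
  then have c: "x \<in> carrier GP" and one: "retraction T x = \<one>\<^bsub>GP\<^esub>" by (auto simp: kernel_def)
  have "retraction S x = retraction S (retraction T x)"
    using assms by (simp only: retraction_retraction[OF c] Int_absorb2)
  with c one show "x \<in> kernel GP GP (retraction S)" unfolding kernel_def by simp
qed

text \<open>
  The vertex group of \<open>u\<close> commutes with the vertex groups of its neighbours, hence with the subgroup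
  that these generate. In terms of homomorphisms: conjugation by an element of \<open>G u\<close> does not change
  the retraction onto a set of neighbours, as can be seen on generators.
\<close>

lemma incl_commute_retraction:
  assumes u: "u \<in> V" "g \<in> carrier (G u)" and S: "\<And>v. v \<in> S \<Longrightarrow> (u, v) \<in> parcs \<Gamma>"
    and x: "x \<in> carrier GP"
  shows "incl u g \<otimes>\<^bsub>GP\<^esub> retraction S x = retraction S x \<otimes>\<^bsub>GP\<^esub> incl u g"
proof -
  let ?c = "\<lambda>y. incl u g \<otimes>\<^bsub>GP\<^esub> y \<otimes>\<^bsub>GP\<^esub> inv\<^bsub>GP\<^esub> incl u g"
  have c: "?c \<in> hom GP GP"
    using u by (simp add: GP.conjugation_hom)
  have fix_incl: "?c (incl v h) = incl v h" if "v \<in> S" "v \<in> V" "h \<in> carrier (G v)" for v h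
    using incl_commute[OF S[OF that(1)] u(2) that(3)] u that by (simp add: GP.m_assoc)
  have "(?c \<circ> retraction S) x = retraction S x"
    using GP.is_group hom_compose[OF retraction_hom c] retraction_hom _ x
    by (rule hom_eqI) (use u fix_incl in \<open>auto simp: retraction_incl\<close>)
  then have "?c (retraction S x) \<otimes>\<^bsub>GP\<^esub> incl u g = retraction S x \<otimes>\<^bsub>GP\<^esub> incl u g" by simp
  then show ?thesis using u x by (simp add: GP.m_assoc)
qed

end

section \<open>The kernel of a retraction that forgets independent vertices\<close>

locale graph_product_layer = graph_of_groups \<Gamma> G
  for \<Gamma> :: "'v pair_pre_digraph" and G :: "'v \<Rightarrow> ('a, 'm) monoid_scheme" +
  fixes W U :: "'v set"
  assumes disjoint: "W \<inter> U = {}"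
    and independent: "\<And>u v. u \<in> U \<Longrightarrow> v \<in> U \<Longrightarrow> (u, v) \<notin> parcs \<Gamma>"
begin

text \<open>
  With \<open>A\<close> for the part over \<open>W\<close> and \<open>L u\<close> for \<open>link_subgroup u\<close>, the conjugates of the vertex
  groups in \<open>U\<close> by elements of \<open>A\<close> are indexed by pairs of a vertex \<open>u\<close> and a left coset \<open>x L u\<close>,
  taken as a subset of the whole graph product.
\<close>

definition "A = retraction W ` carrier GP"

definition "link_subgroup u = retraction (W \<inter> {v. (u, v) \<in> parcs \<Gamma>}) ` carrier GP"

definition "conj_index = {(u, x <#\<^bsub>GP\<^esub> link_subgroup u) | u x. u \<in> U \<inter> V \<and> x \<in> A}"

text \<open>
  The group attached to an index depends only on the vertex, which makes translation of cosets
  an action on the factors. Rebuilding the record discards any further fields of \<open>G u\<close>.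
\<close>

definition copy :: "'v \<times> 'b \<Rightarrow> 'a monoid"
  where "copy i = \<lparr>carrier = carrier (G (fst i)), monoid.mult = monoid.mult (G (fst i)),
    one = \<one>\<^bsub>G (fst i)\<^esub>\<rparr>"

lemma copy_simps [simp]:
  "carrier (copy i) = carrier (G (fst i))"
  "monoid.mult (copy i) = monoid.mult (G (fst i))"
  "\<one>\<^bsub>copy i\<^esub> = \<one>\<^bsub>G (fst i)\<^esub>"
  by (simp_all add: copy_def)

abbreviation "P \<equiv> free_product conj_index copy"

lemma group_copy:
  assumes "fst i \<in> V"
  shows "group (copy i)"
proof -
  interpret Gi: group "G (fst i)" using assms by (rule vertex_group)
  show ?thesis by (rule groupI) (auto simp: Gi.m_assoc)
qed

lemma copy_iso: "copy i \<cong> G (fst i)"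
proof -
  have "id \<in> iso (copy i) (G (fst i))" by (auto simp: iso_def hom_def)
  then show ?thesis by (auto simp: is_iso_def)
qed

lemma conj_index_V: "i \<in> conj_index \<Longrightarrow> fst i \<in> U \<inter> V"
  by (auto simp: conj_index_def)

lemma conj_indexI: "u \<in> U \<Longrightarrow> u \<in> V \<Longrightarrow> x \<in> A \<Longrightarrow> (u, x <#\<^bsub>GP\<^esub> link_subgroup u) \<in> conj_index"
  by (auto simp: conj_index_def)

lemma conj_index_group: "i \<in> conj_index \<Longrightarrow> group (copy i)"
  using conj_index_V group_copy by blast

sublocale P: group P
  using conj_index_group by (rule group_free_product)

lemma A_iff: "x \<in> A \<longleftrightarrow> x \<in> carrier GP \<and> retraction W x = x"
  by (auto simp: A_def retraction_retraction image_iff)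

lemma A_closed: "x \<in> A \<Longrightarrow> x \<in> carrier GP"
  by (simp add: A_iff)

lemma subgroup_A: "subgroup A GP"
  unfolding A_def by (rule retraction.img_is_subgroup)

lemma incl_in_A: "v \<in> W \<Longrightarrow> v \<in> V \<Longrightarrow> g \<in> carrier (G v) \<Longrightarrow> incl v g \<in> A"
  by (simp add: A_iff retraction_incl)

sublocale A: group "GP\<lparr>carrier := A\<rparr>"
  using subgroup_A GP.subgroup_imp_group by blast

lemma subgroup_link: "subgroup (link_subgroup u) GP"
  unfolding link_subgroup_def by (rule retraction.img_is_subgroup)

lemma link_subset: "link_subgroup u \<subseteq> carrier GP"
  using subgroup_link by (rule subgroup.subset)

lemma incl_in_link:
  assumes "v \<in> W" "(u, v) \<in> parcs \<Gamma>" "g \<in> carrier (G v)"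
  shows "incl v g \<in> link_subgroup u"
proof -
  have v: "v \<in> V" using edge_in_V[OF assms(2)] by simp
  have "incl v g = retraction (W \<inter> {v. (u, v) \<in> parcs \<Gamma>}) (incl v g)"
    using assms v by (simp add: retraction_incl)
  then show ?thesis unfolding link_subgroup_def using assms v by (metis imageI incl_closed)
qed

text \<open>
  Two representatives of a coset of \<open>L u\<close> differ by an element that commutes with \<open>G u\<close>. This is what
  makes the evaluation of \<open>P\<close> in the graph product well defined.
\<close>

lemma conj_independent_of_representative:
  assumes u: "u \<in> V" "g \<in> carrier (G u)" and x: "x \<in> carrier GP" "y \<in> carrier GP"
    and eq: "x <#\<^bsub>GP\<^esub> link_subgroup u = y <#\<^bsub>GP\<^esub> link_subgroup u"
  shows "x \<otimes>\<^bsub>GP\<^esub> incl u g \<otimes>\<^bsub>GP\<^esub> inv\<^bsub>GP\<^esub> x = y \<otimes>\<^bsub>GP\<^esub> incl u g \<otimes>\<^bsub>GP\<^esub> inv\<^bsub>GP\<^esub> y"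
proof -
  have "y \<in> y <#\<^bsub>GP\<^esub> link_subgroup u"
    using x subgroup.one_closed[OF subgroup_link] by (force simp: l_coset_def)
  then obtain l where l: "l \<in> link_subgroup u" "y = x \<otimes>\<^bsub>GP\<^esub> l"
    unfolding eq[symmetric] by (auto simp: l_coset_def)
  have lc: "l \<in> carrier GP" using l(1) link_subset by auto
  obtain z where z: "z \<in> carrier GP" "l = retraction (W \<inter> {v. (u, v) \<in> parcs \<Gamma>}) z"
    using l(1) unfolding link_subgroup_def by (rule imageE)
  have "l \<otimes>\<^bsub>GP\<^esub> incl u g = incl u g \<otimes>\<^bsub>GP\<^esub> l"
    unfolding z(2) by (rule incl_commute_retraction[symmetric, OF u _ z(1)]) simp
  then have "l \<otimes>\<^bsub>GP\<^esub> incl u g \<otimes>\<^bsub>GP\<^esub> inv\<^bsub>GP\<^esub> l = incl u g"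
    using lc u by (simp add: GP.m_assoc)
  moreover have "y \<otimes>\<^bsub>GP\<^esub> incl u g \<otimes>\<^bsub>GP\<^esub> inv\<^bsub>GP\<^esub> y
      = x \<otimes>\<^bsub>GP\<^esub> (l \<otimes>\<^bsub>GP\<^esub> incl u g \<otimes>\<^bsub>GP\<^esub> inv\<^bsub>GP\<^esub> l) \<otimes>\<^bsub>GP\<^esub> inv\<^bsub>GP\<^esub> x"
    using x lc u unfolding l(2) by (simp add: GP.m_assoc GP.inv_mult_group)
  ultimately show ?thesis by simp
qed

lemma conj_hom_exists:
  obtains \<phi> where "\<phi> \<in> hom P GP"
    "\<And>u x g. u \<in> U \<Longrightarrow> u \<in> V \<Longrightarrow> x \<in> A \<Longrightarrow> g \<in> carrier (G u) \<Longrightarrow>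
      \<phi> (fp_incl conj_index copy (u, x <#\<^bsub>GP\<^esub> link_subgroup u) g)
        = x \<otimes>\<^bsub>GP\<^esub> incl u g \<otimes>\<^bsub>GP\<^esub> inv\<^bsub>GP\<^esub> x"
proof -
  define rep where "rep i = (SOME x. x \<in> A \<and> snd i = x <#\<^bsub>GP\<^esub> link_subgroup (fst i))"
    for i :: "'v \<times> ('v \<times> 'a) list set set set"
  have rep: "rep i \<in> A" "snd i = rep i <#\<^bsub>GP\<^esub> link_subgroup (fst i)" if "i \<in> conj_index" for i
  proof -
    have "\<exists>x. x \<in> A \<and> snd i = x <#\<^bsub>GP\<^esub> link_subgroup (fst i)"
      using that by (auto simp: conj_index_def)
    then have "rep i \<in> A \<and> snd i = rep i <#\<^bsub>GP\<^esub> link_subgroup (fst i)"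
      unfolding rep_def by (rule someI_ex)
    then show "rep i \<in> A" "snd i = rep i <#\<^bsub>GP\<^esub> link_subgroup (fst i)"
      by (rule conjunct1, rule conjunct2)
  qed
  let ?f = "\<lambda>i g. rep i \<otimes>\<^bsub>GP\<^esub> incl (fst i) g \<otimes>\<^bsub>GP\<^esub> inv\<^bsub>GP\<^esub> rep i"
  have f: "?f i \<in> hom (copy i) GP" if i: "i \<in> conj_index" for i
  proof (rule homI)
    have V: "fst i \<in> V" and r: "rep i \<in> carrier GP" using conj_index_V[OF i] A_closed[OF rep(1)[OF i]] by auto
    show "?f i g \<in> carrier GP" if "g \<in> carrier (copy i)" for g
      using that V r by simp
    show "?f i (g \<otimes>\<^bsub>copy i\<^esub> h) = ?f i g \<otimes>\<^bsub>GP\<^esub> ?f i h"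
      if "g \<in> carrier (copy i)" "h \<in> carrier (copy i)" for g h
    proof -
      have "incl (fst i) (g \<otimes>\<^bsub>G (fst i)\<^esub> h) = incl (fst i) g \<otimes>\<^bsub>GP\<^esub> incl (fst i) h"
        using hom_mult[OF incl_hom[OF V]] that by simp
      then show ?thesis
        using that V hom_mult[OF GP.conjugation_hom[OF r], of "incl (fst i) g" "incl (fst i) h"] by simp
    qed
  qed
  have "\<exists>h\<in>hom P GP. \<forall>i\<in>conj_index. \<forall>g\<in>carrier (copy i). h (fp_incl conj_index copy i g) = ?f i g"
    using conj_index_group GP.is_group f by (rule free_product_universal)
  then obtain \<phi> where \<phi>: "\<phi> \<in> hom P GP"
    and gen: "\<forall>i\<in>conj_index. \<forall>g\<in>carrier (copy i). \<phi> (fp_incl conj_index copy i g) = ?f i g"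
    by (rule bexE)
  show thesis
  proof (rule that[OF \<phi>])
    fix u x g assume u: "u \<in> U" "u \<in> V" and x: "x \<in> A" and g: "g \<in> carrier (G u)"
    let ?i = "(u, x <#\<^bsub>GP\<^esub> link_subgroup u)"
    have i: "?i \<in> conj_index" using u x by (rule conj_indexI)
    have "rep ?i <#\<^bsub>GP\<^esub> link_subgroup u = x <#\<^bsub>GP\<^esub> link_subgroup u"
      using rep(2)[OF i, symmetric] unfolding fst_conv snd_conv .
    then have conj: "?f ?i g = x \<otimes>\<^bsub>GP\<^esub> incl u g \<otimes>\<^bsub>GP\<^esub> inv\<^bsub>GP\<^esub> x"
      unfolding fst_conv
      by (rule conj_independent_of_representative[OF u(2) g A_closed[OF rep(1)[OF i]] A_closed[OF x]])
    have "\<phi> (fp_incl conj_index copy ?i g) = ?f ?i g"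
      using g by (intro gen[rule_format] i) simp
    then show "\<phi> (fp_incl conj_index copy ?i g) = x \<otimes>\<^bsub>GP\<^esub> incl u g \<otimes>\<^bsub>GP\<^esub> inv\<^bsub>GP\<^esub> x"
      using conj by (rule HOL.trans)
  qed
qed

lemma translation_action_exists:
  obtains \<alpha> where
    "\<And>a. a \<in> A \<Longrightarrow> \<alpha> a \<in> hom P P"
    "\<And>a u x g. a \<in> A \<Longrightarrow> u \<in> U \<Longrightarrow> u \<in> V \<Longrightarrow> x \<in> A \<Longrightarrow> g \<in> carrier (G u) \<Longrightarrow>
      \<alpha> a (fp_incl conj_index copy (u, x <#\<^bsub>GP\<^esub> link_subgroup u) g)
        = fp_incl conj_index copy (u, (a \<otimes>\<^bsub>GP\<^esub> x) <#\<^bsub>GP\<^esub> link_subgroup u) g"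
    "\<And>a b p. a \<in> A \<Longrightarrow> b \<in> A \<Longrightarrow> p \<in> carrier P \<Longrightarrow> \<alpha> (a \<otimes>\<^bsub>GP\<^esub> b) p = \<alpha> a (\<alpha> b p)"
    "\<And>p. p \<in> carrier P \<Longrightarrow> \<alpha> \<one>\<^bsub>GP\<^esub> p = p"
proof -
  let ?act = "\<lambda>a i. (fst i, a <#\<^bsub>GP\<^esub> snd i)"
  have act: "?act a (u, x <#\<^bsub>GP\<^esub> link_subgroup u) = (u, (a \<otimes>\<^bsub>GP\<^esub> x) <#\<^bsub>GP\<^esub> link_subgroup u)"
    if "a \<in> A" "x \<in> A" for a u x
    using that link_subset A_closed by (simp add: GP.lcos_m_assoc)
  have A_mult: "a \<otimes>\<^bsub>GP\<^esub> x \<in> A" if "a \<in> A" "x \<in> A" for a x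
    using that subgroup_A by (simp add: subgroup.m_closed)
  show thesis
  proof (rule free_product_index_action[where I = conj_index and H = copy and A = "GP\<lparr>carrier := A\<rparr>" and act = ?act])
    fix a i assume a: "a \<in> carrier (GP\<lparr>carrier := A\<rparr>)" and i: "i \<in> conj_index"
    then obtain u x where ux: "i = (u, x <#\<^bsub>GP\<^esub> link_subgroup u)" "u \<in> U" "u \<in> V" "x \<in> A"
      by (auto simp: conj_index_def)
    show "?act a i \<in> conj_index"
      using a ux(2-) act[of a x u] unfolding ux(1) by (simp add: conj_indexI A_mult)
    show "copy (?act a i) = (copy i :: 'a monoid)"
      by (simp add: copy_def)
    fix b assume b: "b \<in> carrier (GP\<lparr>carrier := A\<rparr>)"
    show "?act (b \<otimes>\<^bsub>GP\<lparr>carrier := A\<rparr>\<^esub> a) i = ?act b (?act a i)"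
      using a b ux(2-) act A_closed unfolding ux(1) by (simp add: A_mult GP.m_assoc GP.lcos_m_assoc link_subset)
  next
    fix i assume i: "i \<in> conj_index"
    then obtain u x where ux: "i = (u, x <#\<^bsub>GP\<^esub> link_subgroup u)" "u \<in> U" "u \<in> V" "x \<in> A"
      by (auto simp: conj_index_def)
    show "?act \<one>\<^bsub>GP\<lparr>carrier := A\<rparr>\<^esub> i = i"
      using ux A_closed by (simp add: GP.lcos_m_assoc link_subset)
  next
    fix \<alpha>
    assume \<alpha>: "\<And>a. a \<in> carrier (GP\<lparr>carrier := A\<rparr>) \<Longrightarrow> \<alpha> a \<in> hom P P"
      "\<And>a i g. a \<in> carrier (GP\<lparr>carrier := A\<rparr>) \<Longrightarrow> i \<in> conj_index \<Longrightarrow> g \<in> carrier (copy i :: 'a monoid) \<Longrightarrow>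
        \<alpha> a (fp_incl conj_index copy i g) = fp_incl conj_index copy (?act a i) g"
      "\<And>a b p. a \<in> carrier (GP\<lparr>carrier := A\<rparr>) \<Longrightarrow> b \<in> carrier (GP\<lparr>carrier := A\<rparr>) \<Longrightarrow> p \<in> carrier P \<Longrightarrow>
        \<alpha> (a \<otimes>\<^bsub>GP\<lparr>carrier := A\<rparr>\<^esub> b) p = \<alpha> a (\<alpha> b p)"
      "\<And>p. p \<in> carrier P \<Longrightarrow> \<alpha> \<one>\<^bsub>GP\<lparr>carrier := A\<rparr>\<^esub> p = p"
    show thesis
    proof (rule that[of \<alpha>])
      fix a u x g
      assume "a \<in> A" "u \<in> U" "u \<in> V" "x \<in> A" "g \<in> carrier (G u)"
      then show "\<alpha> a (fp_incl conj_index copy (u, x <#\<^bsub>GP\<^esub> link_subgroup u) g)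
          = fp_incl conj_index copy (u, (a \<otimes>\<^bsub>GP\<^esub> x) <#\<^bsub>GP\<^esub> link_subgroup u) g"
        using \<alpha>(2)[of a "(u, x <#\<^bsub>GP\<^esub> link_subgroup u)" g] act[of a x u]
        by (simp add: conj_indexI)
    qed (use \<alpha> in auto)
  qed (use A.is_group conj_index_group in auto)
qed

text \<open>
  The heart of the proof. Independence of \<open>U\<close> enters when \<open>\<psi>\<close> is constructed: if \<open>U\<close>
  contained an edge, \<open>\<psi>\<close> would have to map commuting elements into different free factors of \<open>P\<close>.
\<close>

theorem kernel_quotient_free_product:
  "free_product_of_copies
    (GP\<lparr>carrier := kernel GP GP (retraction W)\<rparr> Mod kernel GP GP (retraction (W \<union> U))) V G"
proof -
  obtain \<phi> where \<phi>: "\<phi> \<in> hom P GP"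
    and \<phi>_gen: "\<And>u x g. u \<in> U \<Longrightarrow> u \<in> V \<Longrightarrow> x \<in> A \<Longrightarrow> g \<in> carrier (G u) \<Longrightarrow>
      \<phi> (fp_incl conj_index copy (u, x <#\<^bsub>GP\<^esub> link_subgroup u) g)
        = x \<otimes>\<^bsub>GP\<^esub> incl u g \<otimes>\<^bsub>GP\<^esub> inv\<^bsub>GP\<^esub> x"
    by (rule conj_hom_exists) blast
  interpret \<phi>: group_hom P GP \<phi> by unfold_locales (rule \<phi>)
  obtain \<alpha> where \<alpha>: "\<And>a. a \<in> A \<Longrightarrow> \<alpha> a \<in> hom P P"
    and \<alpha>_gen: "\<And>a u x g. a \<in> A \<Longrightarrow> u \<in> U \<Longrightarrow> u \<in> V \<Longrightarrow> x \<in> A \<Longrightarrow> g \<in> carrier (G u) \<Longrightarrow>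
      \<alpha> a (fp_incl conj_index copy (u, x <#\<^bsub>GP\<^esub> link_subgroup u) g)
        = fp_incl conj_index copy (u, (a \<otimes>\<^bsub>GP\<^esub> x) <#\<^bsub>GP\<^esub> link_subgroup u) g"
    and \<alpha>_mult: "\<And>a b p. a \<in> A \<Longrightarrow> b \<in> A \<Longrightarrow> p \<in> carrier P \<Longrightarrow> \<alpha> (a \<otimes>\<^bsub>GP\<^esub> b) p = \<alpha> a (\<alpha> b p)"
    and \<alpha>_one: "\<And>p. p \<in> carrier P \<Longrightarrow> \<alpha> \<one>\<^bsub>GP\<^esub> p = p"
    by (rule translation_action_exists) blast
  define S where "S = semidirect_product P (GP\<lparr>carrier := A\<rparr>) \<alpha>"
  have S_simps [simp]: "carrier S = carrier P \<times> A"
    "(p, a) \<otimes>\<^bsub>S\<^esub> (q, b) = (p \<otimes>\<^bsub>P\<^esub> \<alpha> a q, a \<otimes>\<^bsub>GP\<^esub> b)" "\<one>\<^bsub>S\<^esub> = (\<one>\<^bsub>P\<^esub>, \<one>\<^bsub>GP\<^esub>)" for p q a b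
    by (simp_all add: S_def)
  interpret S: group S
    unfolding S_def by (rule group_semidirect_product) (simp_all add: P.is_group A.is_group \<alpha> \<alpha>_mult \<alpha>_one)
  have A_one: "\<one>\<^bsub>GP\<^esub> \<in> A" using subgroup.one_closed[OF subgroup_A] .
  have \<alpha>_closed: "\<alpha> a p \<in> carrier P" if "a \<in> A" "p \<in> carrier P" for a p
    using \<alpha>[OF that(1)] that(2) by (auto simp: hom_def)
  have \<alpha>_P_one: "\<alpha> a \<one>\<^bsub>P\<^esub> = \<one>\<^bsub>P\<^esub>" if "a \<in> A" for a
    using hom_one[OF \<alpha>[OF that] P.is_group P.is_group] .
  let ?c = "\<lambda>x u. fp_incl conj_index copy (u, x <#\<^bsub>GP\<^esub> link_subgroup u)"
  have c_hom: "?c x u \<in> hom (G u) P" if "x \<in> A" "u \<in> U" "u \<in> V" for x u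
    using fp_incl_hom[of conj_index copy, OF conj_index_group conj_indexI[OF that(2,3,1)]]
    by (simp add: hom_def)
  have c_closed: "?c x u g \<in> carrier P" if "x \<in> A" "u \<in> U" "u \<in> V" "g \<in> carrier (G u)" for x u g
    using c_hom[OF that(1-3)] that(4) by (auto simp: hom_def)
  have P_hom_eqI: "h p = h' p"
    if "group K" "h \<in> hom P K" "h' \<in> hom P K" "p \<in> carrier P"
      "\<And>x u g. x \<in> A \<Longrightarrow> u \<in> U \<Longrightarrow> u \<in> V \<Longrightarrow> g \<in> carrier (G u) \<Longrightarrow> h (?c x u g) = h' (?c x u g)"
    for h h' :: "_ \<Rightarrow> 'k" and K :: "'k monoid" and p
  proof (rule free_product_hom_eqI[where I = conj_index and G = copy, OF _ that(1-3) _ that(4)])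
    show "h (fp_incl conj_index copy i g) = h' (fp_incl conj_index copy i g)"
      if "i \<in> conj_index" "g \<in> carrier (copy i)" for i g
      using that \<open>\<And>x u g. x \<in> A \<Longrightarrow> u \<in> U \<Longrightarrow> u \<in> V \<Longrightarrow> g \<in> carrier (G u) \<Longrightarrow> h (?c x u g) = h' (?c x u g)\<close>
      by (auto simp: conj_index_def)
  qed (rule conj_index_group)

  \<comment> \<open>Vertices in \<open>W\<close> go to the complement \<open>A\<close>, those in \<open>U\<close> to the factor at the trivial coset. This
    coset is kept in the form \<open>\<one> L u\<close>, to which the rules for \<open>\<phi>\<close> and \<open>\<alpha>\<close> apply.\<close>
  let ?f = "\<lambda>v g. if v \<in> W then (\<one>\<^bsub>P\<^esub>, incl v g) else if v \<in> U then (?c \<one>\<^bsub>GP\<^esub> v g, \<one>\<^bsub>GP\<^esub>) else \<one>\<^bsub>S\<^esub>"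
  have f_closed: "?f v g \<in> carrier S" if "v \<in> V" "g \<in> carrier (G v)" for v g
    using that A_one by (auto simp: incl_in_A c_closed)
  obtain \<psi> where \<psi>: "\<psi> \<in> hom GP S"
    and \<psi>_gen: "\<And>v g. v \<in> V \<Longrightarrow> g \<in> carrier (G v) \<Longrightarrow> \<psi> (incl v g) = ?f v g"
  proof (rule hom_exists[where K = S and f = ?f])
    show "?f v \<in> hom (G v) S" if v: "v \<in> V" for v
    proof (rule homI)
      show "?f v g \<in> carrier S" if "g \<in> carrier (G v)" for g
        using f_closed[OF v that] .
      show "?f v (g \<otimes>\<^bsub>G v\<^esub> h) = ?f v g \<otimes>\<^bsub>S\<^esub> ?f v h"
        if "g \<in> carrier (G v)" "h \<in> carrier (G v)" for g h
        using hom_mult[OF incl_hom[OF v] that] hom_mult[OF c_hom[OF A_one _ v] that] that v A_one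
        by (auto simp: \<alpha>_P_one \<alpha>_one incl_in_A c_closed)
    qed
    \<comment> \<open>The only relations that involve both components: an edge between \<open>v \<in> U\<close> and \<open>u \<in> W\<close>. They
      hold because \<open>G u\<close> lies in \<open>L v\<close> and therefore fixes the trivial coset.\<close>
    have *: "(\<one>\<^bsub>P\<^esub>, incl u g) \<otimes>\<^bsub>S\<^esub> (?c \<one>\<^bsub>GP\<^esub> v h, \<one>\<^bsub>GP\<^esub>) = (?c \<one>\<^bsub>GP\<^esub> v h, \<one>\<^bsub>GP\<^esub>) \<otimes>\<^bsub>S\<^esub> (\<one>\<^bsub>P\<^esub>, incl u g)"
      if "(v, u) \<in> parcs \<Gamma>" "g \<in> carrier (G u)" "h \<in> carrier (G v)" "u \<in> W" "v \<in> U" for u v g h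
    proof -
      have V: "u \<in> V" "v \<in> V" using edge_in_V[OF that(1)] by auto
      have a: "incl u g \<in> A" using incl_in_A that V by blast
      have "incl u g <#\<^bsub>GP\<^esub> link_subgroup v = link_subgroup v"
        using GP.coset_join3 incl_in_link[OF that(4,1,2)] link_subset subgroup_link by blast
      then have "\<alpha> (incl u g) (?c \<one>\<^bsub>GP\<^esub> v h) = ?c \<one>\<^bsub>GP\<^esub> v h"
        using \<alpha>_gen[OF a that(5) V(2) A_one that(3)] A_closed[OF a] by (simp add: GP.lcos_mult_one link_subset)
      then show ?thesis
        using a A_closed[OF a] c_closed[OF A_one that(5) V(2) that(3)] A_one by (simp add: \<alpha>_P_one)
    qed
    show "?f u g \<otimes>\<^bsub>S\<^esub> ?f v h = ?f v h \<otimes>\<^bsub>S\<^esub> ?f u g"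
      if e: "(u, v) \<in> parcs \<Gamma>" and g: "g \<in> carrier (G u)" and h: "h \<in> carrier (G v)" for u v g h
    proof -
      have V: "u \<in> V" "v \<in> V" using edge_in_V[OF e] by auto
      consider "u \<in> W" "v \<in> W" | "u \<in> W" "v \<in> U" | "u \<in> U" "v \<in> W" | "u \<notin> W \<union> U" | "v \<notin> W \<union> U"
        using e independent by blast
      then show ?thesis
      proof cases
        case 1
        then show ?thesis using incl_commute[OF e g h] V g h by (simp add: incl_in_A \<alpha>_P_one)
      next
        case 2
        then show ?thesis using *[OF edge_sym[OF e] g h] disjoint by auto
      next
        case 3
        then show ?thesis using *[OF e h g] disjoint by auto
      next
        case 4
        then have "?f u g = \<one>\<^bsub>S\<^esub>" by simp
        then show ?thesis using f_closed[OF V(2) h] S.l_one S.r_one by presburger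
      next
        case 5
        then have "?f v h = \<one>\<^bsub>S\<^esub>" by simp
        then show ?thesis using f_closed[OF V(1) g] S.l_one S.r_one by presburger
      qed
    qed
  qed (use S.is_group in auto)
  interpret \<psi>: group_hom GP S \<psi> by unfold_locales (rule \<psi>)

  have \<psi>_closed: "fst (\<psi> x) \<in> carrier P" "snd (\<psi> x) \<in> A" if "x \<in> carrier GP" for x
    using \<psi>.hom_closed[OF that] by auto
  have snd_hom: "snd \<in> hom S GP" by (auto simp: hom_def A_closed)
  have snd_\<psi>: "snd (\<psi> x) = retraction W x" if x: "x \<in> carrier GP" for x
  proof -
    have "(snd \<circ> \<psi>) x = retraction W x"
      using GP.is_group hom_compose[OF \<psi> snd_hom] retraction_hom _ x
      by (rule hom_eqI) (auto simp: \<psi>_gen retraction_incl)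
    then show ?thesis by simp
  qed

  \<comment> \<open>Evaluation \<open>\<theta>\<close> of the semidirect product is a homomorphism because \<open>\<phi>\<close> turns the action \<open>\<alpha>\<close>
    of \<open>A\<close> into conjugation.\<close>
  define \<theta> where "\<theta> = (\<lambda>(p, a). \<phi> p \<otimes>\<^bsub>GP\<^esub> a)"
  have equivariant: "\<phi> (\<alpha> a p) \<otimes>\<^bsub>GP\<^esub> a = a \<otimes>\<^bsub>GP\<^esub> \<phi> p" if a: "a \<in> A" and p: "p \<in> carrier P" for a p
  proof -
    have ac: "a \<in> carrier GP" using a by (rule A_closed)
    let ?k = "\<lambda>y. a \<otimes>\<^bsub>GP\<^esub> y \<otimes>\<^bsub>GP\<^esub> inv\<^bsub>GP\<^esub> a"
    have k: "?k \<in> hom GP GP"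
      using ac by (rule GP.conjugation_hom)
    have "(\<phi> \<circ> \<alpha> a) p = (?k \<circ> \<phi>) p"
    proof (rule P_hom_eqI[OF GP.is_group hom_compose[OF \<alpha>[OF a] \<phi>] hom_compose[OF \<phi> k] p])
      fix x u g assume x: "x \<in> A" and u: "u \<in> U" "u \<in> V" "g \<in> carrier (G u)"
      have "a \<otimes>\<^bsub>GP\<^esub> x \<in> A" using subgroup.m_closed[OF subgroup_A a x] .
      then show "(\<phi> \<circ> \<alpha> a) (?c x u g) = (?k \<circ> \<phi>) (?c x u g)"
        using x u a ac A_closed[OF x] by (simp add: \<alpha>_gen \<phi>_gen GP.m_assoc GP.inv_mult_group)
    qed
    then have "\<phi> (\<alpha> a p) = ?k (\<phi> p)" by simp
    then show ?thesis using ac p by (simp add: GP.m_assoc)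
  qed
  have \<theta>: "\<theta> \<in> hom S GP"
  proof (rule homI)
    show "\<theta> s \<in> carrier GP" if "s \<in> carrier S" for s
      using that by (auto simp: \<theta>_def A_closed)
    fix s t assume "s \<in> carrier S" "t \<in> carrier S"
    then obtain p a q b where st: "s = (p, a)" "t = (q, b)"
      and c: "p \<in> carrier P" "a \<in> A" "q \<in> carrier P" "b \<in> A" by auto
    have "\<theta> (s \<otimes>\<^bsub>S\<^esub> t) = \<phi> p \<otimes>\<^bsub>GP\<^esub> (\<phi> (\<alpha> a q) \<otimes>\<^bsub>GP\<^esub> a) \<otimes>\<^bsub>GP\<^esub> b"
      using c by (simp add: st \<theta>_def A_closed \<alpha>_closed GP.m_assoc)
    also have "\<dots> = \<theta> s \<otimes>\<^bsub>GP\<^esub> \<theta> t"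
      using c by (simp add: equivariant st \<theta>_def A_closed GP.m_assoc)
    finally show "\<theta> (s \<otimes>\<^bsub>S\<^esub> t) = \<theta> s \<otimes>\<^bsub>GP\<^esub> \<theta> t" .
  qed
  have \<theta>_\<psi>: "\<theta> (\<psi> x) = retraction (W \<union> U) x" if x: "x \<in> carrier GP" for x
  proof -
    have "(\<theta> \<circ> \<psi>) x = retraction (W \<union> U) x"
      using GP.is_group hom_compose[OF \<psi> \<theta>] retraction_hom _ x
      by (rule hom_eqI) (auto simp: \<psi>_gen retraction_incl \<theta>_def \<phi>_gen A_one)
    then show ?thesis by simp
  qed
  have \<psi>_retraction: "\<psi> (retraction (W \<union> U) x) = \<psi> x" if x: "x \<in> carrier GP" for x
  proof -
    have "(\<psi> \<circ> retraction (W \<union> U)) x = \<psi> x"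
      using S.is_group hom_compose[OF retraction_hom \<psi>] \<psi> _ x
      by (rule hom_eqI) (auto simp: \<psi>_gen retraction_incl)
    then show ?thesis by simp
  qed

  \<comment> \<open>On \<open>A\<close>, whose elements are not given as words in the generators, \<open>\<psi>\<close> is determined by comparing
    \<open>\<psi> \<circ> retraction W\<close> with the inclusion of the complement composed with \<open>retraction W\<close>.\<close>
  have \<psi>_A: "\<psi> a = (\<one>\<^bsub>P\<^esub>, a)" if a: "a \<in> A" for a
  proof -
    have "(\<lambda>b. (\<one>\<^bsub>P\<^esub>, b)) \<in> hom (GP\<lparr>carrier := A\<rparr>) S" by (auto simp: hom_def \<alpha>_P_one)
    moreover have "retraction W \<in> hom GP (GP\<lparr>carrier := A\<rparr>)"
      using retraction_hom[of W] by (auto simp: hom_def A_def)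
    ultimately have "(\<lambda>b. (\<one>\<^bsub>P\<^esub>, b)) \<circ> retraction W \<in> hom GP S" by (metis hom_compose)
    with S.is_group hom_compose[OF retraction_hom \<psi>]
    have "(\<psi> \<circ> retraction W) a = ((\<lambda>b. (\<one>\<^bsub>P\<^esub>, b)) \<circ> retraction W) a"
      by (rule hom_eqI) (use a A_closed in \<open>auto simp: \<psi>_gen retraction_incl\<close>)
    then show ?thesis using a by (simp add: A_iff)
  qed
  have \<psi>_\<phi>: "\<psi> (\<phi> p) = (p, \<one>\<^bsub>GP\<^esub>)" if p: "p \<in> carrier P" for p
  proof -
    have i: "(\<lambda>p. (p, \<one>\<^bsub>GP\<^esub>)) \<in> hom P S" using A_one by (auto simp: hom_def \<alpha>_one)
    have "(\<psi> \<circ> \<phi>) p = (p, \<one>\<^bsub>GP\<^esub>)"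
    proof (rule P_hom_eqI[OF S.is_group hom_compose[OF \<phi> \<psi>] i p])
      fix x u g assume x: "x \<in> A" and u: "u \<in> U" "u \<in> V" "g \<in> carrier (G u)"
      have uW: "u \<notin> W" using u disjoint by auto
      \<comment> \<open>In a semidirect product, conjugating the trivial-coset copy of \<open>g\<close> by \<open>x\<close> applies \<open>\<alpha> x\<close>, that
        is, moves it to the coset of \<open>x\<close>.\<close>
      have "\<psi> x \<otimes>\<^bsub>S\<^esub> \<psi> (incl u g) = (?c x u g, \<one>\<^bsub>GP\<^esub>) \<otimes>\<^bsub>S\<^esub> \<psi> x"
        using x u uW A_closed[OF x] A_one
        by (simp add: \<psi>_A \<psi>_gen \<alpha>_gen \<alpha>_one c_closed)
      then have "(\<psi> \<circ> \<phi>) (?c x u g) = (?c x u g, \<one>\<^bsub>GP\<^esub>) \<otimes>\<^bsub>S\<^esub> \<psi> x \<otimes>\<^bsub>S\<^esub> inv\<^bsub>S\<^esub> \<psi> x"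
        using x u A_closed[OF x] by (simp add: \<phi>_gen)
      also have "\<dots> = (?c x u g, \<one>\<^bsub>GP\<^esub>)"
      proof -
        have s: "(?c x u g, \<one>\<^bsub>GP\<^esub>) \<in> carrier S" using c_closed[OF x u] A_one by simp
        note t = \<psi>.hom_closed[OF A_closed[OF x]]
        show ?thesis
          using S.m_assoc[OF s t S.inv_closed[OF t]] S.r_inv[OF t] S.r_one[OF s] by presburger
      qed
      finally show "(\<psi> \<circ> \<phi>) (?c x u g) = (?c x u g, \<one>\<^bsub>GP\<^esub>)" .
    qed
    then show ?thesis by simp
  qed

  \<comment> \<open>On \<open>ker \<rho>\<^sub>W\<close> the second component of \<open>\<psi>\<close> is trivial, so the twist by \<open>\<alpha>\<close> disappears and the
    first component becomes a homomorphism.\<close>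
  let ?K = "kernel GP GP (retraction W)" and ?L = "kernel GP GP (retraction (W \<union> U))"
  have subK: "subgroup ?K GP" by (rule retraction.subgroup_kernel)
  interpret K: group "GP\<lparr>carrier := ?K\<rparr>" using subK by (rule GP.subgroup_imp_group)
  have \<psi>_K: "\<psi> x = (fst (\<psi> x), \<one>\<^bsub>GP\<^esub>)" if "x \<in> ?K" for x
    using that snd_\<psi>[of x] by (auto simp: kernel_def prod_eq_iff)
  interpret fst_\<psi>: group_hom "GP\<lparr>carrier := ?K\<rparr>" P "fst \<circ> \<psi>"
  proof unfold_locales
    show "fst \<circ> \<psi> \<in> hom (GP\<lparr>carrier := ?K\<rparr>) P"
    proof (rule homI)
      fix x y assume "x \<in> carrier (GP\<lparr>carrier := ?K\<rparr>)" "y \<in> carrier (GP\<lparr>carrier := ?K\<rparr>)"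
      then have K: "x \<in> ?K" "y \<in> ?K" and c: "x \<in> carrier GP" "y \<in> carrier GP" by (auto simp: kernel_def)
      have "\<psi> (x \<otimes>\<^bsub>GP\<^esub> y) = (fst (\<psi> x), \<one>\<^bsub>GP\<^esub>) \<otimes>\<^bsub>S\<^esub> (fst (\<psi> y), \<one>\<^bsub>GP\<^esub>)"
        using \<psi>.hom_mult[OF c] \<psi>_K[OF K(1)] \<psi>_K[OF K(2)] by simp
      then show "(fst \<circ> \<psi>) (x \<otimes>\<^bsub>GP\<lparr>carrier := ?K\<rparr>\<^esub> y) = (fst \<circ> \<psi>) x \<otimes>\<^bsub>P\<^esub> (fst \<circ> \<psi>) y"
        using \<psi>_closed[OF c(2)] by (simp add: \<alpha>_one)
    qed (auto simp: kernel_def \<psi>_closed)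
  qed
  have "kernel (GP\<lparr>carrier := ?K\<rparr>) P (fst \<circ> \<psi>) = ?L"
  proof (intro equalityI subsetI)
    fix x assume "x \<in> kernel (GP\<lparr>carrier := ?K\<rparr>) P (fst \<circ> \<psi>)"
    then have x: "x \<in> ?K" "fst (\<psi> x) = \<one>\<^bsub>P\<^esub>" "x \<in> carrier GP" by (auto simp: kernel_def)
    then have "\<theta> (\<psi> x) = \<one>\<^bsub>GP\<^esub>" using \<psi>_K[of x] by (auto simp: \<theta>_def)
    then show "x \<in> ?L" using x \<theta>_\<psi> unfolding kernel_def by auto
  next
    fix x assume x: "x \<in> ?L"
    then have xc: "x \<in> carrier GP" and r: "retraction (W \<union> U) x = \<one>\<^bsub>GP\<^esub>" by (auto simp: kernel_def)
    have "\<psi> x = \<one>\<^bsub>S\<^esub>" using \<psi>_retraction[OF xc] r \<psi>.hom_one by metis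
    moreover have "x \<in> ?K" using x kernel_retraction_antimono[of W "W \<union> U"] by auto
    ultimately show "x \<in> kernel (GP\<lparr>carrier := ?K\<rparr>) P (fst \<circ> \<psi>)"
      unfolding kernel_def by simp
  qed
  moreover have "(fst \<circ> \<psi>) ` carrier (GP\<lparr>carrier := ?K\<rparr>) = carrier P"
  proof (intro equalityI subsetI)
    fix p assume p: "p \<in> carrier P"
    have "\<phi> p \<in> ?K" using p snd_\<psi>[of "\<phi> p"] \<psi>_\<phi>[OF p] unfolding kernel_def by simp
    then show "p \<in> (fst \<circ> \<psi>) ` carrier (GP\<lparr>carrier := ?K\<rparr>)"
      using \<psi>_\<phi>[OF p] by (intro image_eqI[of _ _ "\<phi> p"]) auto
  qed (use fst_\<psi>.hom_closed in auto)
  ultimately have "GP\<lparr>carrier := ?K\<rparr> Mod ?L \<cong> P"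
    using fst_\<psi>.FactGroup_iso by simp
  moreover have "\<forall>i\<in>conj_index. group (copy i :: 'a monoid) \<and> (\<exists>v\<in>V. copy i \<cong> G v)"
    using conj_index_group conj_index_V copy_iso by blast
  ultimately show ?thesis unfolding free_product_of_copies_def by blast
qed

end

theorem theorem4p1:
  fixes \<Gamma> :: "'v pair_pre_digraph"
    and G :: "'v \<Rightarrow> ('a, 'm) monoid_scheme"
    and n :: nat
  assumes "pair_bidirected_digraph \<Gamma>"
    and "chromatic_number \<Gamma> = enat n"
    and "\<And>v. v \<in> pverts \<Gamma> \<Longrightarrow> group (G v)"
  shows "\<exists>K :: nat \<Rightarrow> ('v \<times> 'a) list set set set.
    K 0 = carrier (graph_product \<Gamma> G) \<and>
    K n = {\<one>\<^bsub>graph_product \<Gamma> G\<^esub>} \<and>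
    (\<forall>i\<in>{1..n}.
      K i \<lhd> (graph_product \<Gamma> G)\<lparr>carrier := K (i - 1)\<rparr> \<and>
      free_product_of_copies ((graph_product \<Gamma> G)\<lparr>carrier := K (i - 1)\<rparr> Mod K i) (pverts \<Gamma>) G)"
proof -
  interpret graph_of_groups \<Gamma> G using assms(1,3) by (rule graph_of_groups.intro)
  obtain c where c: "proper_colouring \<Gamma> n c"
    using assms(2) by (auto simp: chromatic_number_eq_enat_iff)
  let ?K = "\<lambda>i. kernel GP GP (retraction {v. c v < i})"
  have "?K 0 = carrier GP"
    unfolding kernel_def by (auto simp: retraction_none)
  moreover have "?K n = {\<one>\<^bsub>GP\<^esub>}"
  proof -
    have "V \<subseteq> {v. c v < n}" using c by (auto simp: proper_colouring_def)
    then show ?thesis using retraction_all[of "{v. c v < n}"] unfolding kernel_def by auto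
  qed
  moreover have "?K i \<lhd> GP\<lparr>carrier := ?K (i - 1)\<rparr> \<and>
      free_product_of_copies (GP\<lparr>carrier := ?K (i - 1)\<rparr> Mod ?K i) V G" if i: "i \<in> {1..n}" for i
  proof
    show "?K i \<lhd> GP\<lparr>carrier := ?K (i - 1)\<rparr>"
      by (intro GP.normal_restrict_supergroup retraction.subgroup_kernel retraction.normal_kernel
          kernel_retraction_antimono) auto
    interpret graph_product_layer \<Gamma> G "{v. c v < i - 1}" "{v. c v = i - 1}"
      using c by unfold_locales (auto simp: proper_colouring_def)
    have "{v. c v < i - 1} \<union> {v. c v = i - 1} = {v. c v < i}" using i by auto
    then show "free_product_of_copies (GP\<lparr>carrier := ?K (i - 1)\<rparr> Mod ?K i) V G"
      using kernel_quotient_free_product by simp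
  qed
  ultimately show ?thesis by (intro exI[of _ ?K]) auto
qed

end
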